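(* The following hold. (i) For every $i\in[n]$, $g\mapsto x^{\mathfrak m}_i(g)$ is a piecewise linear concave non-decreasing function on $[0,\infty)$ with $S_{\mathcal P}(-s^\star,e^i)$ pieces; that is, $\mathrm{SLC}^{\mathrm p}_{0,i}(0,\infty)=S_{\mathcal P}(-s^\star,e^i)$. (ii) For every $i\in[n]$, $g\mapsto s^{\mathfrak m}_i(g)$ is a piecewise linear concave non-decreasing function on $[0,\infty)$ with $S_{\mathcal D}(-x^\star,e^i)$ pieces; that is, $\mathrm{SLC}^{\mathrm d}_{0,i}(0,\infty)=S_{\mathcal D}(-x^\star,e^i)$.
   Context: $A\in\mathbb R^{m\times n}$ has rank $m\le n$, $b\in\mathbb R^m$, $c\in\mathbb R^n$. The primal-dual pair is $\min\{\langle c,x\rangle: Ax=b,\ x\ge 0\}$ and $\max\{\langle b,y\rangle: A^\top y+s=c,\ s\ge 0\}$, feasible and bounded with optimal value $v^\star$. $\mathcal P=\{x: Ax=b,x\ge0\}$, $\mathcal D=\{s:\exists y,\ A^\top y+s=c,s\ge0\}$; both contain strictly positive points. $(x^\star,s^\star)$ is the optimal pair which is the limit as $\mu\searrow0$ of the central path $(x^{\mathrm{cp}}(\mu),s^{\mathrm{cp}}(\mu))$, the unique $x\in\mathcal P$, $s\in\mathcal D$, $x,s>0$ with $x_is_i=\mu$ for all $i$. For $g\ge0$, $x^{\mathfrak m}_i(g)=\max\{x_i: Ax=b,x\ge0,\langle c,x\rangle\le v^\star+g\}$ and $s^{\mathfrak m}_i(g)=\max\{s_i: A^\top y+s=c,s\ge0,\langle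 b,y\rangle\ge v^\star-g\}$. $e^i$ denotes the $i$-th standard basis vector. For a pointed polyhedron $P\subseteq\mathbb R^n$ and $c^{(1)},c^{(2)}\in\mathbb R^n$ with $\max_{x\in P}\langle c^{(1)},x\rangle<\infty$, let $P[c^{(1)},c^{(2)}]=\{(\langle c^{(1)},x\rangle,\langle c^{(2)},x\rangle):x\in P\}\subseteq\mathbb R^2$. $S_P(c^{(1)},c^{(2)})$ is the number of vertices of $P[c^{(1)},c^{(2)}]$ that maximize, over $P[c^{(1)},c^{(2)}]$, the linear objective $(1-\lambda)e^1+\lambda e^2$ for all $\lambda$ in some (nonempty) open interval contained in $[0,1]$ (here $e^1,e^2$ is the standard basis of $\mathbb R^2$; $P$ may be unbounded in direction $c^{(2)}$). $\mathrm{SLC}^{\mathrm p}_{0,i}(0,\infty)$ (primal straight-line complexity with parameter $\theta=0$) is the minimum number of linear segments (the last one possibly an unbounded ray) of a piecewise linear curve traversing the set $\{(g,z)\in\mathbb R^2_+: z=x^{\mathfrak m}_i(g)\}$ over $g\in[0,\infty)$, i.e. the number of linear pieces of $x^{\mathfrak m}_i$ on $[0,\infty)$; $\mathrm{SLC}^{\mathrm d}_{0,i}(0,\infty)$ is the same with $s^{\mathfrak m}_i$. *)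

theory Defs
  imports "HOL-Analysis.Analysis"
begin

definition primal_feasible :: "real^'n^'m \<Rightarrow> real^'m \<Rightarrow> (real^'n) set" where
  "primal_feasible A b = {x. A *v x = b \<and> (\<forall>j. 0 \<le> x $ j)}"

definition dual_feasible :: "real^'n^'m \<Rightarrow> real^'n \<Rightarrow> (real^'n) set" where
  "dual_feasible A c = {s. (\<exists>y. transpose A *v y + s = c) \<and> (\<forall>j. 0 \<le> s $ j)}"

definition opt_value :: "real^'n^'m \<Rightarrow> real^'m \<Rightarrow> real^'n \<Rightarrow> real" where
  "opt_value A b c = (LEAST v. \<exists>x\<in>primal_feasible A b. v = c \<bullet> x)"

definition central_point ::
  "real^'n^'m \<Rightarrow> real^'m \<Rightarrow> real^'n \<Rightarrow> real \<Rightarrow> real^'n \<Rightarrow> real^'n \<Rightarrow> bool" where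
  "central_point A b c \<mu> x s \<longleftrightarrow>
     x \<in> primal_feasible A b \<and> s \<in> dual_feasible A c \<and>
     (\<forall>j. 0 < x $ j) \<and> (\<forall>j. 0 < s $ j) \<and> (\<forall>j. x $ j * s $ j = \<mu>)"

definition x_max :: "real^'n^'m \<Rightarrow> real^'m \<Rightarrow> real^'n \<Rightarrow> 'n \<Rightarrow> real \<Rightarrow> real" where
  "x_max A b c i g =
     (GREATEST z. \<exists>x. A *v x = b \<and> (\<forall>j. 0 \<le> x $ j) \<and>
        c \<bullet> x \<le> opt_value A b c + g \<and> z = x $ i)"

definition s_max :: "real^'n^'m \<Rightarrow> real^'m \<Rightarrow> real^'n \<Rightarrow> 'n \<Rightarrow> real \<Rightarrow> real" where
  "s_max A b c i g =
     (GREATEST z. \<exists>s y. transpose A *v y + s = c \<and> (\<forall>j. 0 \<le> s $ j) \<and>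
        b \<bullet> y \<ge> opt_value A b c - g \<and> z = s $ i)"

definition planar_proj :: "'a::real_inner set \<Rightarrow> 'a \<Rightarrow> 'a \<Rightarrow> (real \<times> real) set" where
  "planar_proj P c1 c2 = (\<lambda>x. (c1 \<bullet> x, c2 \<bullet> x)) ` P"

text \<open>The vertices counted by \<open>shadow_count P c1 c2\<close> are those met by the parametric objective
  moving from the first coordinate (parameter 0) to the second one (parameter 1).\<close>

definition shadow_vertices :: "'a::real_inner set \<Rightarrow> 'a \<Rightarrow> 'a \<Rightarrow> (real \<times> real) set" where
  "shadow_vertices P c1 c2 =
     {w. w extreme_point_of planar_proj P c1 c2 \<and>
         (\<exists>l u. 0 \<le> l \<and> l < u \<and> u \<le> 1 \<and>
            (\<forall>\<tau>\<in>{l<..<u}. \<forall>w'\<in>planar_proj P c1 c2.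
               ((1 - \<tau>) *\<^sub>R (1, 0) + \<tau> *\<^sub>R (0, 1)) \<bullet> w' \<le>
               ((1 - \<tau>) *\<^sub>R (1, 0) + \<tau> *\<^sub>R (0, 1)) \<bullet> w))}"

definition shadow_count :: "'a::real_inner set \<Rightarrow> 'a \<Rightarrow> 'a \<Rightarrow> nat" where
  "shadow_count P c1 c2 = card (shadow_vertices P c1 c2)"

text \<open>\<open>pw_linear_pieces k h\<close>: on \<open>[0,\<infinity>)\<close> the function \<open>h\<close> is a concatenation of \<open>k \<ge> 1\<close> affine
  pieces over consecutive closed intervals, the last one being \<open>[t (k - 1), \<infinity>)\<close>. Consecutive
  intervals share their endpoint, so \<open>h\<close> is continuous there. Consecutive pieces may have the
  same slope; minimality of \<open>k\<close> is imposed in \<open>straight_line_complexity\<close>.\<close>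

definition pw_linear_pieces :: "nat \<Rightarrow> (real \<Rightarrow> real) \<Rightarrow> bool" where
  "pw_linear_pieces k h \<longleftrightarrow> 1 \<le> k \<and>
     (\<exists>t :: nat \<Rightarrow> real. t 0 = 0 \<and> (\<forall>j. Suc j < k \<longrightarrow> t j < t (Suc j)) \<and>
        (\<forall>j<k. \<exists>p q. \<forall>g. t j \<le> g \<and> (Suc j < k \<longrightarrow> g \<le> t (Suc j)) \<longrightarrow> h g = p * g + q))"

text \<open>Minimum number of linear segments of a piecewise linear curve that traverses \<open>T\<close>
  over \<open>g \<in> [0,\<infinity>)\<close>.\<close>

definition straight_line_complexity :: "(real \<times> real) set \<Rightarrow> nat" where
  "straight_line_complexity T = (LEAST k. \<exists>h. pw_linear_pieces k h \<and> (\<forall>g\<ge>0. (g, h g) \<in> T))"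

definition SLC_primal :: "real^'n^'m \<Rightarrow> real^'m \<Rightarrow> real^'n \<Rightarrow> 'n \<Rightarrow> nat" where
  "SLC_primal A b c i =
     straight_line_complexity {(g, z). 0 \<le> g \<and> 0 \<le> z \<and> z = x_max A b c i g}"

definition SLC_dual :: "real^'n^'m \<Rightarrow> real^'m \<Rightarrow> real^'n \<Rightarrow> 'n \<Rightarrow> nat" where
  "SLC_dual A b c i =
     straight_line_complexity {(g, z). 0 \<le> g \<and> 0 \<le> z \<and> z = s_max A b c i g}"

end

theory Submission
  imports Defs
begin

text \<open>
  Complementarity of the limit pair makes \<open>sstar \<bullet> x\<close> the optimality gap of every primal feasible
  \<open>x\<close>, so the value function at \<open>g\<close> is the height of the upper envelope of the planar projection
  at abscissa \<open>- g\<close>. Sublevel sets of the gap are compact, hence are convex hulls of their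
  extreme points, and an extreme point that does not attain the gap bound is an extreme point of
  the whole polyhedron. The value function is therefore affine between consecutive gaps of the
  finitely many vertices, also on the final ray. A gap at which the slope really changes (or the
  gap 0) is one with two distinct nonnegative supporting slopes, and \<open>slope = (1 - \<tau>) / \<tau>\<close>
  identifies this with being a vertex that is optimal for an open interval of parameters \<open>\<tau>\<close>.
\<close>

section \<open>Supporting slopes and breakpoints of functions on the half-line\<close>

definition affine_fun_on :: "real set \<Rightarrow> (real \<Rightarrow> real) \<Rightarrow> bool" where
  "affine_fun_on S h \<longleftrightarrow> (\<exists>p q. \<forall>g\<in>S. h g = p * g + q)"

text \<open>Only the open interval must avoid \<open>B\<close>, yet affinity reaches both endpoints,
  so neighbouring pieces agree where they meet.\<close>

definition affine_off :: "real set \<Rightarrow> (real \<Rightarrow> real) \<Rightarrow> bool" where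
  "affine_off B h \<longleftrightarrow>
     (\<forall>a b. 0 \<le> a \<longrightarrow> a < b \<longrightarrow> {a<..<b} \<inter> B = {} \<longrightarrow> affine_fun_on {a..b} h)"

text \<open>These are the supergradients of \<open>h\<close> relative to the half-line; at 0 the
  test is one-sided.\<close>

definition supp_slope :: "(real \<Rightarrow> real) \<Rightarrow> real \<Rightarrow> real \<Rightarrow> bool" where
  "supp_slope h g \<kappa> \<longleftrightarrow> (\<forall>y\<ge>0. h y \<le> h g + \<kappa> * (y - g))"

text \<open>At a positive point, two distinct supergradients mark a kink. For the functions treated
  below, 0 also qualifies, as the start of the first piece, so the cardinality counts pieces.
  Nonnegative slopes are those of the form \<open>(1 - \<tau>) / \<tau>\<close> with
  \<open>0 < \<tau> \<le> 1\<close>.\<close>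

definition breakpoints :: "(real \<Rightarrow> real) \<Rightarrow> real set" where
  "breakpoints h =
     {g. 0 \<le> g \<and> (\<exists>\<kappa> \<mu>. 0 \<le> \<kappa> \<and> \<kappa> < \<mu> \<and> supp_slope h g \<kappa> \<and> supp_slope h g \<mu>)}"

lemma breakpointsI:
  "0 \<le> g \<Longrightarrow> 0 \<le> \<kappa> \<Longrightarrow> \<kappa> < \<mu> \<Longrightarrow> supp_slope h g \<kappa> \<Longrightarrow> supp_slope h g \<mu> \<Longrightarrow> g \<in> breakpoints h"
  by (auto simp: breakpoints_def)

text \<open>Multiplying the weights by \<open>y - x\<close> clears the denominators, so that the
  chord estimates need only ring arithmetic and one cancellation.\<close>

lemma concave_onD_real:
  fixes h :: "real \<Rightarrow> real"
  assumes "concave_on S h" "x \<in> S" "y \<in> S" "x < z" "z < y"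
  shows "(y - z) * h x + (z - x) * h y \<le> (y - x) * h z"
proof -
  define u where "u = (y - z) / (y - x)"
  define v where "v = (z - x) / (y - x)"
  have pos: "y - x > 0" using assms by simp
  have uv: "u \<ge> 0" "v \<ge> 0" "u + v = 1"
    using assms by (auto simp: u_def v_def divide_simps)
  have "u * x + v * y = ((y - z) * x + (z - x) * y) / (y - x)"
    by (simp add: u_def v_def add_divide_distrib)
  also have "(y - z) * x + (z - x) * y = z * (y - x)" by (simp add: algebra_simps)
  finally have "u * x + v * y = z" using pos by simp
  then have "u * h x + v * h y \<le> h z"
    using assms(1-3) uv unfolding concave_on_iff by (metis real_scaleR_def)
  then have "(y - x) * (u * h x + v * h y) \<le> (y - x) * h z"
    using pos by (simp add: mult_left_mono)
  moreover have "(y - x) * u = y - z" "(y - x) * v = z - x"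
    using pos by (simp_all add: u_def v_def)
  ultimately show ?thesis
    by (metis (no_types, lifting) distrib_left mult.assoc)
qed

text \<open>The endpoint of the chord nearer to \<open>x\<close> is the middle point of the
  three-point inequality.\<close>

lemma concave_on_le_chord_outside:
  fixes h :: "real \<Rightarrow> real"
  assumes h: "concave_on S h" and ab: "a \<in> S" "b \<in> S" "a < b"
    and ha: "h a = p * a + q" and hb: "h b = p * b + q" and x: "x \<in> S" "x \<notin> {a<..<b}"
  shows "h x \<le> p * x + q"
proof -
  consider "x < a" | "x = a" | "x = b" | "b < x" using x by fastforce
  then show ?thesis
  proof cases
    case 1
    have "(b - a) * h x + (a - x) * h b \<le> (b - x) * h a"
      using concave_onD_real[OF h, of x b a] 1 ab x by simp
    then have "(b - a) * h x \<le> (b - a) * (p * x + q)"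
      unfolding ha hb by (simp add: algebra_simps)
    then show ?thesis using ab by simp
  next
    case 4
    have "(x - b) * h a + (b - a) * h x \<le> (x - a) * h b"
      using concave_onD_real[OF h, of a x b] 4 ab x by simp
    then have "(b - a) * h x \<le> (b - a) * (p * x + q)"
      unfolding ha hb by (simp add: algebra_simps)
    then show ?thesis using ab by simp
  qed (use ha hb in auto)
qed

lemma concave_on_ge_chord_inside:
  fixes h :: "real \<Rightarrow> real"
  assumes h: "concave_on S h" and ab: "a \<in> S" "b \<in> S" "a < b"
    and ha: "h a = p * a + q" and hb: "h b = p * b + q" and x: "x \<in> {a..b}"
  shows "p * x + q \<le> h x"
proof -
  consider "x = a" | "x = b" | "a < x" "x < b" using x by fastforce
  then show ?thesis
  proof cases
    case 3
    have "(b - x) * h a + (x - a) * h b \<le> (b - a) * h x"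
      using concave_onD_real[OF h, of a b x] 3 ab by simp
    then have "(b - a) * (p * x + q) \<le> (b - a) * h x"
      unfolding ha hb by (simp add: algebra_simps)
    then show ?thesis using ab by simp
  qed (use ha hb in auto)
qed

lemma chord_exists:
  fixes h :: "real \<Rightarrow> real"
  assumes "a < b"
  obtains p q where "h a = p * a + q" "h b = p * b + q"
proof
  let ?p = "(h b - h a) / (b - a)"
  show "h a = ?p * a + (h a - ?p * a)" by simp
  have "?p * (b - a) = h b - h a" using assms by simp
  then show "h b = ?p * b + (h a - ?p * a)" unfolding right_diff_distrib by linarith
qed

text \<open>Outside \<open>{a..b}\<close> concavity keeps \<open>h\<close> under the extended line,
  so the slope supports at every point of the piece, endpoints included.\<close>

lemma supp_slope_of_affine:
  assumes h: "concave_on {0..} h" and "0 \<le> a" "a < b"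
    and aff: "\<forall>g\<in>{a..b}. h g = p * g + q" and g: "g \<in> {a..b}"
  shows "supp_slope h g p"
  unfolding supp_slope_def
proof (intro allI impI)
  fix y :: real assume "0 \<le> y"
  have "h y \<le> p * y + q"
  proof (cases "y \<in> {a..b}")
    case False
    then have "y \<notin> {a<..<b}" by auto
    then show ?thesis
      using concave_on_le_chord_outside[OF h, of a b p q y] aff \<open>0 \<le> a\<close> \<open>a < b\<close> \<open>0 \<le> y\<close> by simp
  qed (use aff in auto)
  then show "h y \<le> h g + p * (y - g)" using aff g by (auto simp: algebra_simps)
qed

lemma slope_nonneg:
  assumes m: "mono_on {0..} h" and "0 \<le> a" "a < b" and aff: "\<forall>g\<in>{a..b}. h g = p * g + q"
  shows "(0::real) \<le> p"
proof -
  have "h a \<le> h b" using mono_onD[OF m, of a b] assms(2,3) by simp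
  then have "0 \<le> p * (b - a)" using aff assms(3) by (simp add: algebra_simps)
  then show ?thesis using assms(3) by (simp add: zero_le_mult_iff)
qed

text \<open>The supporting inequality tested at \<open>a\<close> gives
  \<open>\<kappa> \<le> p\<close>; tested at \<open>b\<close> it gives the reverse.\<close>

lemma supp_slope_unique:
  assumes "0 \<le> a" "a < g" "g < b" and aff: "\<forall>y\<in>{a..b}. h y = p * y + q" and s: "supp_slope h g \<kappa>"
  shows "\<kappa> = p"
proof -
  have "h a = p * a + q" "h g = p * g + q" "h b = p * b + q" using assms(2,3) aff by simp_all
  moreover have "h a \<le> h g + \<kappa> * (a - g)" "h b \<le> h g + \<kappa> * (b - g)"
    using s assms(1-3) by (simp_all add: supp_slope_def)
  ultimately have "(\<kappa> - p) * (g - a) \<le> 0" "0 \<le> (\<kappa> - p) * (b - g)"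
    unfolding left_diff_distrib right_diff_distrib by linarith+
  then have "\<kappa> - p \<le> 0" "0 \<le> \<kappa> - p"
    using assms(2,3) by (simp_all only: mult_le_0_iff zero_le_mult_iff) linarith+
  then show ?thesis by simp
qed

lemma breakpoint_not_affine:
  assumes "0 \<le> a" "a < g" "g < b" "affine_fun_on {a..b} h"
  shows "g \<notin> breakpoints h"
proof
  obtain p q where pq: "\<forall>y\<in>{a..b}. h y = p * y + q"
    using assms(4) by (auto simp: affine_fun_on_def)
  assume "g \<in> breakpoints h"
  then obtain \<kappa> \<mu> where "\<kappa> < \<mu>" "supp_slope h g \<kappa>" "supp_slope h g \<mu>"
    by (auto simp: breakpoints_def)
  then show False
    using supp_slope_unique[OF assms(1-3) pq] by blast
qed

text \<open>A breakpoint different from all starting points \<open>t j\<close> would lie strictly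
  inside an affine piece.\<close>

lemma breakpoints_minimal:
  assumes "pw_linear_pieces k h"
  shows "card (breakpoints h) \<le> k"
proof -
  obtain t where k: "1 \<le> k" and t0: "t 0 = 0" and tm: "\<And>j. Suc j < k \<Longrightarrow> t j < t (Suc j)"
    and aff: "\<And>j. j < k \<Longrightarrow> \<exists>p q. \<forall>g. t j \<le> g \<and> (Suc j < k \<longrightarrow> g \<le> t (Suc j)) \<longrightarrow> h g = p * g + q"
    using assms unfolding pw_linear_pieces_def by metis
  have tpos: "0 \<le> t j" if "j < k" for j
    using that
  proof (induction j)
    case (Suc j)
    then show ?case using tm[of j] by force
  qed (simp add: t0)
  have "breakpoints h \<subseteq> t ` {..<k}"
  proof
    fix g assume g: "g \<in> breakpoints h"
    show "g \<in> t ` {..<k}"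
    proof (rule ccontr)
      assume ng: "g \<notin> t ` {..<k}"
      have g0: "0 \<le> g" using g by (auto simp: breakpoints_def)
      \<comment> \<open>The last piece starting strictly left of \<open>g\<close>; as
        \<open>g\<close> is no starting point, the next piece starts strictly to its right.\<close>
      define j where "j = Max {j. j < k \<and> t j < g}"
      have "t 0 \<in> t ` {..<k}" using k by simp
      then have "t 0 < g" using ng t0 g0 by (metis order_le_less)
      then have ne: "0 \<in> {j. j < k \<and> t j < g}" using k by simp
      have fin: "finite {j. j < k \<and> t j < g}" by simp
      have j: "j < k" "t j < g"
        using Max_in[OF fin] ne unfolding j_def by blast+
      have nxt: "g < t (Suc j)" if "Suc j < k"
      proof -
        have "\<not> t (Suc j) < g"
          using Max_ge[OF fin, of "Suc j"] that by (auto simp: j_def[symmetric])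
        then show ?thesis using ng that by (metis imageI lessThan_iff not_less_iff_gr_or_eq)
      qed
      \<comment> \<open>On the unbounded last piece any point to the right of \<open>g\<close> can
        close the interval.\<close>
      define b where "b = (if Suc j < k then t (Suc j) else g + 1)"
      have "g < b" using nxt by (simp add: b_def)
      moreover have "affine_fun_on {t j..b} h"
        using aff[OF j(1)] unfolding affine_fun_on_def b_def by (fastforce split: if_splits)
      ultimately show False
        using breakpoint_not_affine[OF tpos[OF j(1)] j(2)] g by blast
    qed
  qed
  then have "card (breakpoints h) \<le> card (t ` {..<k})" by (simp add: card_mono)
  also have "\<dots> \<le> k" using card_image_le[of "{..<k}" t] by simp
  finally show ?thesis .
qed

text \<open>Both pieces meeting at \<open>c\<close> provide nonnegative supporting slopes there.
  Since \<open>c\<close> is no breakpoint these coincide, and the common value at \<open>c\<close>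
  makes the intercepts coincide.\<close>

lemma affine_off_remove:
  assumes h: "concave_on {0..} h" and m: "mono_on {0..} h"
    and off: "affine_off B h" and c: "c \<notin> breakpoints h"
  shows "affine_off (B - {c}) h"
  unfolding affine_off_def
proof (intro allI impI)
  fix a b :: real
  assume ab: "0 \<le> a" "a < b" and em: "{a<..<b} \<inter> (B - {c}) = {}"
  show "affine_fun_on {a..b} h"
  proof (cases "c \<in> {a<..<b}")
    case True
    then have "{a<..<c} \<inter> B = {}" "{c<..<b} \<inter> B = {}"
      using em by (auto simp: disjoint_iff) (metis less_trans order_less_irrefl)+
    with off True ab have "affine_fun_on {a..c} h" "affine_fun_on {c..b} h"
      by (auto simp: affine_off_def)
    then obtain p q p' q' where
      l: "\<forall>g\<in>{a..c}. h g = p * g + q" and r: "\<forall>g\<in>{c..b}. h g = p' * g + q'"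
      by (auto simp: affine_fun_on_def)
    have "supp_slope h c p" "supp_slope h c p'"
      using supp_slope_of_affine[OF h _ _ l] supp_slope_of_affine[OF h _ _ r] True ab by auto
    moreover have "0 \<le> p" "0 \<le> p'"
      using slope_nonneg[OF m _ _ l] slope_nonneg[OF m _ _ r] True ab by auto
    ultimately have "\<not> p < p'" "\<not> p' < p"
      using c breakpointsI[of c p p' h] breakpointsI[of c p' p h] True ab by auto
    then have pp: "p = p'" by simp
    have "h c = p * c + q" using bspec[OF l, of c] True by simp
    moreover have "h c = p' * c + q'" using bspec[OF r, of c] True by simp
    ultimately have qq: "q = q'" unfolding pp by linarith
    have "h g = p * g + q" if "g \<in> {a..b}" for g
    proof (cases "g \<le> c")
      case True
      then show ?thesis using bspec[OF l, of g] that by simp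
    next
      case False
      then show ?thesis using bspec[OF r, of g] that unfolding pp qq by simp
    qed
    then show ?thesis unfolding affine_fun_on_def by blast
  next
    case False
    then have "{a<..<b} \<inter> B = {}" using em by blast
    then show ?thesis using off ab by (simp add: affine_off_def)
  qed
qed

lemma affine_off_Diff:
  assumes "finite C" "concave_on {0..} h" "mono_on {0..} h" "affine_off B h" "C \<inter> breakpoints h = {}"
  shows "affine_off (B - C) h"
  using assms(1,5)
proof (induction C rule: finite_induct)
  case (insert c C)
  then have "affine_off (B - C - {c}) h"
    using affine_off_remove[OF assms(2,3)] by blast
  then show ?case by (metis Diff_insert)
qed (use assms in auto)

text \<open>An affine function is fixed by its values at \<open>a\<close> and \<open>a + 1\<close>,
  so the formula found on this unit interval persists on every longer one.\<close>

lemma affine_off_ray: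
  assumes off: "affine_off B h" and a: "0 \<le> a" and em: "{a<..} \<inter> B = {}"
  shows "affine_fun_on {a..} h"
proof -
  have "affine_fun_on {a..b} h" if "a < b" for b
    using off a that em unfolding affine_off_def by force
  then have *: "\<exists>p q. \<forall>g\<in>{a..b}. h g = p * g + q" if "a < b" for b
    using that by (auto simp: affine_fun_on_def)
  obtain p q where pq: "\<forall>g\<in>{a..a + 1}. h g = p * g + q" using *[of "a + 1"] by auto
  have "h g = p * g + q" if "a \<le> g" for g
  proof -
    obtain p' q' where pq': "\<forall>y\<in>{a..max g (a + 1)}. h y = p' * y + q'"
      using *[of "max g (a + 1)"] by (auto simp: less_max_iff_disj)
    have "p * a + q = p' * a + q'" "p * (a + 1) + q = p' * (a + 1) + q'"
      using pq[rule_format, of a] pq'[rule_format, of a]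
        pq[rule_format, of "a + 1"] pq'[rule_format, of "a + 1"] by auto
    then have "p = p'" "q = q'" by (auto simp: algebra_simps)
    then show ?thesis using pq' that by simp
  qed
  then show ?thesis by (auto simp: affine_fun_on_def)
qed

section \<open>Concave nondecreasing functions with finitely many candidate kinks\<close>

context
  fixes h :: "real \<Rightarrow> real" and B :: "real set"
  assumes concave: "concave_on {0..} h" and mono: "mono_on {0..} h"
    and finB: "finite B" and off: "affine_off B h"
begin

text \<open>Discarding from \<open>B\<close> all points that are not breakpoints leaves a subset of
  the breakpoints, and enlarging the avoided set only weakens \<open>affine_off\<close>.\<close>

lemma affine_off_breakpoints: "affine_off (breakpoints h) h"
proof -
  have "affine_off (B - (B - breakpoints h)) h"
    using affine_off_Diff[OF _ concave mono off] finB by blast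
  then show ?thesis by (auto simp: affine_off_def)
qed

text \<open>A positive point outside the finite set \<open>B\<close> has a neighbourhood free of
  other points of \<open>B\<close>, and \<open>h\<close> is affine there.\<close>

lemma breakpoints_subset: "breakpoints h \<subseteq> insert 0 B"
proof
  fix g assume g: "g \<in> breakpoints h"
  show "g \<in> insert 0 B"
  proof (rule ccontr)
    assume ng: "g \<notin> insert 0 B"
    then have g0: "0 < g" using g by (auto simp: breakpoints_def)
    have "open (- (B - {g}))" using finB by (intro open_Compl finite_imp_closed) simp
    then obtain e where e: "0 < e" "ball g e \<subseteq> - (B - {g})"
      using openE[of "- (B - {g})" g] by auto
    \<comment> \<open>Capping the radius by \<open>g\<close> keeps the interval inside
      \<open>{0..}\<close>.\<close>
    define r where "r = min e g"
    have "{g - r<..<g + r} \<subseteq> ball g e"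
      by (auto simp: r_def dist_real_def)
    then have "{g - r<..<g + r} \<inter> B = {}" using e(2) ng by blast
    moreover have "0 < r" "0 \<le> g - r" using e g0 by (auto simp: r_def)
    ultimately have "affine_fun_on {g - r..g + r} h" using off by (simp add: affine_off_def)
    with \<open>0 < r\<close> \<open>0 \<le> g - r\<close> show False
      using breakpoint_not_affine[of "g - r" g "g + r" h] g by simp
  qed
qed

lemma finite_breakpoints: "finite (breakpoints h)"
  using finite_subset[OF breakpoints_subset] finB by simp

lemma zero_in_breakpoints: "0 \<in> breakpoints h"
proof -
  have "open (- (B - {0}))" using finB by (intro open_Compl finite_imp_closed) simp
  then obtain e where e: "0 < e" "ball 0 e \<subseteq> - (B - {0})"
    using openE[of "- (B - {0})" 0] by auto
  have "{0<..<e} \<subseteq> ball 0 e - {0}" by auto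
  then have "{0<..<e} \<inter> B = {}" using e(2) by blast
  then have "affine_fun_on {0..e} h" using off e by (simp add: affine_off_def)
  then obtain p q where pq: "\<forall>g\<in>{0..e}. h g = p * g + q" by (auto simp: affine_fun_on_def)
  have p: "supp_slope h 0 p" "0 \<le> p"
    using supp_slope_of_affine[OF concave _ _ pq] slope_nonneg[OF mono _ _ pq] e by auto
  \<comment> \<open>At the left end of the domain a supporting slope can be raised freely, which
    yields the second slope.\<close>
  then have "supp_slope h 0 (p + 1)" by (force simp: supp_slope_def algebra_simps)
  then show ?thesis using p breakpointsI[of 0 p "p + 1"] by simp
qed

text \<open>The sorted breakpoints serve as starting points: the first is 0, and none lies strictly
  inside a piece or beyond the start of the final ray.\<close>

lemma pw_linear_pieces_breakpoints: "pw_linear_pieces (card (breakpoints h)) h"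
proof -
  define xs where "xs = sorted_list_of_set (breakpoints h)"
  have sx: "set xs = breakpoints h" and lx: "length xs = card (breakpoints h)"
    and srt: "sorted_wrt (<) xs"
    using finite_breakpoints by (auto simp: xs_def)
  have nth_less: "xs ! i < xs ! j" if "i < j" "j < length xs" for i j
    using sorted_wrt_nth_less[OF srt] that by simp
  have nth_nonneg: "0 \<le> xs ! j" if "j < length xs" for j
    using that sx nth_mem[of j xs] by (auto simp: breakpoints_def)
  have gap: "y \<notin> breakpoints h"
    if j: "j < length xs" "xs ! j < y" "Suc j < length xs \<longrightarrow> y < xs ! Suc j" for j y
  proof
    assume "y \<in> breakpoints h"
    then obtain i where i: "i < length xs" "y = xs ! i" using sx by (metis in_set_conv_nth)
    have mono: "xs ! i' \<le> xs ! j'" if "i' \<le> j'" "j' < length xs" for i' j'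
      using nth_less[of i' j'] that by (cases "i' = j'") auto
    have "i \<le> j \<or> Suc j \<le> i" by linarith
    then show False
    proof
      assume "i \<le> j"
      then show False using mono[of i j] i(2) j(1,2) by linarith
    next
      assume "Suc j \<le> i"
      then show False using mono[of "Suc j" i] i j(3) by linarith
    qed
  qed
  have len: "1 \<le> length xs"
  proof -
    have "xs \<noteq> []" using zero_in_breakpoints sx by force
    then show ?thesis by (cases xs) simp_all
  qed
  have zero: "xs ! 0 = 0"
  proof -
    obtain i where i: "i < length xs" "xs ! i = 0"
      using zero_in_breakpoints sx by (metis in_set_conv_nth)
    have "0 \<le> xs ! 0" by (rule nth_nonneg) (use len in linarith)
    then have "\<not> 0 < i" using nth_less[of 0 i] i by auto
    then show ?thesis using i by simp
  qed
  have aff: "\<exists>p q. \<forall>g. xs ! j \<le> g \<and> (Suc j < length xs \<longrightarrow> g \<le> xs ! Suc j) \<longrightarrow> h g = p * g + q"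
    if j: "j < length xs" for j
  proof (cases "Suc j < length xs")
    case True
    have "{xs ! j<..<xs ! Suc j} \<inter> breakpoints h = {}" using gap[OF j] by auto
    then have "affine_fun_on {xs ! j..xs ! Suc j} h"
      using affine_off_breakpoints nth_nonneg[OF j] nth_less[OF _ True, of j]
      by (simp add: affine_off_def)
    then obtain p q where "\<forall>g\<in>{xs ! j..xs ! Suc j}. h g = p * g + q"
      unfolding affine_fun_on_def by blast
    then show ?thesis using True by (intro exI[of _ p] exI[of _ q]) simp
  next
    case False
    have "{xs ! j<..} \<inter> breakpoints h = {}" using gap[OF j] False by auto
    then have "affine_fun_on {xs ! j..} h"
      using affine_off_ray[OF affine_off_breakpoints nth_nonneg[OF j]] by simp
    then obtain p q where "\<forall>g\<in>{xs ! j..}. h g = p * g + q"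
      unfolding affine_fun_on_def by blast
    then show ?thesis by (intro exI[of _ p] exI[of _ q]) simp
  qed
  show ?thesis
    unfolding pw_linear_pieces_def lx[symmetric]
  proof (intro conjI exI[of _ "\<lambda>j. xs ! j"] allI impI)
    show "1 \<le> length xs" "xs ! 0 = 0" by (fact len zero)+
    show "xs ! j < xs ! Suc j" if "Suc j < length xs" for j
      using nth_less that by simp
  qed (rule aff)
qed

end

section \<open>Value functions and planar projections of convex sets\<close>

lemma extreme_point_of_sublevel:
  fixes P :: "'a::euclidean_space set"
  assumes P: "convex P" and v: "v extreme_point_of {x \<in> P. d \<bullet> x \<le> g}" and less: "d \<bullet> v < g"
  shows "v extreme_point_of P"
  unfolding extreme_point_of_def
proof (intro conjI ballI notI)
  show vP: "v \<in> P" using v by (simp add: extreme_point_of_def)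
  fix a b assume ab: "a \<in> P" "b \<in> P" "v \<in> open_segment a b"
  then obtain u where u: "a \<noteq> b" "0 < u" "u < 1" "v = (1 - u) *\<^sub>R a + u *\<^sub>R b"
    by (auto simp: in_segment)
  \<comment> \<open>\<open>K\<close> bounds the change of \<open>d\<close> from \<open>v\<close> to
    either end; the added 1 makes it positive, hence a safe divisor.\<close>
  define K where "K = \<bar>d \<bullet> a - d \<bullet> v\<bar> + \<bar>d \<bullet> b - d \<bullet> v\<bar> + 1"
  define t where "t = min 1 ((g - d \<bullet> v) / K)"
  have K: "0 < K" by (simp add: K_def)
  have t: "0 < t" "t \<le> 1" using less K by (auto simp: t_def)
  have tK: "t * K \<le> g - d \<bullet> v"
    using K mult_right_mono[of t "(g - d \<bullet> v) / K" K] by (simp add: t_def)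
  \<comment> \<open>Contracting the segment towards \<open>v\<close> keeps \<open>v\<close> strictly
    inside, and the slack \<open>g - d \<bullet> v\<close> makes it fit into the sublevel set,
    contradicting extremality there.\<close>
  define shrink where "shrink x = (1 - t) *\<^sub>R v + t *\<^sub>R x" for x
  have mem: "shrink x \<in> {x \<in> P. d \<bullet> x \<le> g}" if "x \<in> P" "d \<bullet> x - d \<bullet> v \<le> K" for x
  proof -
    have "t * (d \<bullet> x - d \<bullet> v) \<le> t * K" using that t by simp
    then have "d \<bullet> shrink x \<le> g" using tK by (simp add: shrink_def inner_right_distrib algebra_simps)
    moreover have "shrink x \<in> P"
      using convexD[OF P vP that(1), of "1 - t" t] t by (simp add: shrink_def)
    ultimately show ?thesis by simp
  qed
  have "(1 - u) *\<^sub>R shrink a + u *\<^sub>R shrink b = (1 - t) *\<^sub>R v + t *\<^sub>R ((1 - u) *\<^sub>R a + u *\<^sub>R b)"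
    by (simp add: shrink_def algebra_simps)
  also have "\<dots> = v" using u(4) by (simp add: scaleR_left_diff_distrib)
  finally have "v = (1 - u) *\<^sub>R shrink a + u *\<^sub>R shrink b" by simp
  moreover have "shrink a \<noteq> shrink b" using u(1) t by (simp add: shrink_def)
  ultimately have "v \<in> open_segment (shrink a) (shrink b)"
    using u(2,3) by (auto simp: in_segment)
  moreover have "shrink a \<in> {x \<in> P. d \<bullet> x \<le> g}" "shrink b \<in> {x \<in> P. d \<bullet> x \<le> g}"
    using mem ab by (auto simp: K_def)
  ultimately show False using v by (auto simp: extreme_point_of_def)
qed

text \<open>\<open>d\<close> measures the optimality gap and \<open>e\<close> is the objective. The
  last two assumptions make \<open>h g\<close>, for nonnegative \<open>g\<close>, the maximum of
  \<open>e\<close> over points with gap at most \<open>g\<close>.\<close>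

locale shadow_value =
  fixes P :: "'a::euclidean_space set" and d e :: 'a and h :: "real \<Rightarrow> real"
  assumes convex: "convex P"
    and finite_extreme: "finite {x. x extreme_point_of P}"
    and compact_sublevel: "\<And>g. compact {x \<in> P. d \<bullet> x \<le> g}"
    and gap_nonneg: "\<And>x. x \<in> P \<Longrightarrow> 0 \<le> d \<bullet> x"
    and attained: "\<And>g. 0 \<le> g \<Longrightarrow> \<exists>x\<in>P. d \<bullet> x \<le> g \<and> e \<bullet> x = h g"
    and upper: "\<And>x g. x \<in> P \<Longrightarrow> d \<bullet> x \<le> g \<Longrightarrow> e \<bullet> x \<le> h g"
begin

lemma mono: "mono_on {0..} h"
proof (rule mono_onI)
  fix r s :: real assume "r \<in> {0..}" "s \<in> {0..}" "r \<le> s"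
  then obtain x where "x \<in> P" "d \<bullet> x \<le> r" "e \<bullet> x = h r" using attained[of r] by auto
  then show "h r \<le> h s" using upper[of x s] \<open>r \<le> s\<close> by simp
qed

text \<open>A convex combination of maximizers for \<open>r\<close> and \<open>s\<close> is
  admissible for the combined bound.\<close>

lemma concave: "concave_on {0..} h"
  unfolding concave_on_iff
proof (intro conjI ballI allI impI)
  fix r s u v :: real
  assume rs: "r \<in> {0..}" "s \<in> {0..}" and uv: "0 \<le> u" "0 \<le> v" "u + v = 1"
  obtain x where x: "x \<in> P" "d \<bullet> x \<le> r" "e \<bullet> x = h r" using attained[of r] rs by auto
  obtain y where y: "y \<in> P" "d \<bullet> y \<le> s" "e \<bullet> y = h s" using attained[of s] rs by auto
  have "u *\<^sub>R x + v *\<^sub>R y \<in> P" using convexD[OF convex] x y uv by blast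
  moreover have "d \<bullet> (u *\<^sub>R x + v *\<^sub>R y) \<le> u *\<^sub>R r + v *\<^sub>R s"
    using x y uv by (simp add: inner_right_distrib add_mono mult_left_mono)
  ultimately have "e \<bullet> (u *\<^sub>R x + v *\<^sub>R y) \<le> h (u *\<^sub>R r + v *\<^sub>R s)" by (rule upper)
  then show "u * h r + v * h s \<le> h (u *\<^sub>R r + v *\<^sub>R s)"
    using x y by (simp add: inner_right_distrib)
qed simp

text \<open>An extreme point of the sublevel set at \<open>b\<close> either has gap \<open>b\<close>
  or is extreme in \<open>P\<close>, and then its gap avoids the open interval. Both kinds lie below
  the chord, hence so does their convex hull, the whole sublevel set. Concavity gives the opposite
  bound.\<close>

lemma affine_off_vertices: "affine_off ((\<bullet>) d ` {x. x extreme_point_of P}) h"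
  unfolding affine_off_def
proof (intro allI impI)
  fix a b :: real
  assume ab: "0 \<le> a" "a < b" and em: "{a<..<b} \<inter> (\<bullet>) d ` {x. x extreme_point_of P} = {}"
  obtain p q where pq: "h a = p * a + q" "h b = p * b + q" using chord_exists[OF ab(2)] by blast
  let ?S = "{x \<in> P. d \<bullet> x \<le> b}"
  let ?H = "{x. (e - p *\<^sub>R d) \<bullet> x \<le> q}"
  have H: "x \<in> ?H \<longleftrightarrow> e \<bullet> x \<le> p * (d \<bullet> x) + q" for x
    by (auto simp: inner_diff_left)
  have "0 \<le> p"
  proof -
    have "h a \<le> h b" using mono_onD[OF mono, of a b] ab by simp
    then have "0 \<le> p * (b - a)" by (simp add: pq algebra_simps)
    then show ?thesis using ab by (simp add: zero_le_mult_iff)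
  qed
  have "{x. x extreme_point_of ?S} \<subseteq> ?H"
  proof
    fix v assume "v \<in> {x. x extreme_point_of ?S}"
    then have v: "v extreme_point_of ?S" "v \<in> P" "d \<bullet> v \<le> b" by (auto simp: extreme_point_of_def)
    have "d \<bullet> v \<notin> {a<..<b}"
      using extreme_point_of_sublevel[OF convex v(1)] em by (auto simp: disjoint_iff)
    then have "h (d \<bullet> v) \<le> p * (d \<bullet> v) + q"
      using concave_on_le_chord_outside[OF concave _ _ ab(2) pq] ab gap_nonneg[OF v(2)] by simp
    then show "v \<in> ?H" using upper[OF v(2) order_refl] unfolding H by simp
  qed
  then have "convex hull {x. x extreme_point_of ?S} \<subseteq> ?H"
    by (intro hull_minimal convex_halfspace_le)
  moreover have "?S = P \<inter> {x. d \<bullet> x \<le> b}" by auto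
  then have "convex ?S" by (simp add: convex convex_Int convex_halfspace_le)
  ultimately have sub: "?S \<subseteq> ?H"
    using Krein_Milman_Minkowski[OF compact_sublevel] by blast
  have "h g = p * g + q" if g: "g \<in> {a..b}" for g
  proof (rule antisym)
    obtain x where x: "x \<in> P" "d \<bullet> x \<le> g" "e \<bullet> x = h g" using attained[of g] g ab by auto
    then have "x \<in> ?H" using sub g by auto
    then have "h g \<le> p * (d \<bullet> x) + q" using x unfolding H by simp
    \<comment> \<open>A maximizer may use less than the allowed gap; a nonnegative chord slope
      absorbs the difference.\<close>
    also have "\<dots> \<le> p * g + q" using \<open>0 \<le> p\<close> x(2) by (simp add: mult_left_mono)
    finally show "h g \<le> p * g + q" .
    show "p * g + q \<le> h g"
      using concave_on_ge_chord_inside[OF concave _ _ ab(2) pq g] ab by simp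
  qed
  then show "affine_fun_on {a..b} h" by (auto simp: affine_fun_on_def)
qed

text \<open>At \<open>(- g, h g)\<close> the objective is
  \<open>\<tau> * h g - (1 - \<tau>) * g\<close>, so for positive \<open>\<tau>\<close> optimality
  says that the slope \<open>(1 - \<tau>) / \<tau>\<close> supports \<open>h\<close> at
  \<open>g\<close>. An open interval of parameters thus corresponds to an interval between two
  distinct slopes.\<close>

lemma shadow_vertices_eq: "shadow_vertices P (- d) e = (\<lambda>g. (- g, h g)) ` breakpoints h"
proof (intro equalityI subsetI)
  fix w assume "w \<in> shadow_vertices P (- d) e"
  then obtain l u where w: "w \<in> planar_proj P (- d) e" and lu: "0 \<le> l" "l < u" "u \<le> 1"
    and opt: "\<And>\<tau> w'. \<tau> \<in> {l<..<u} \<Longrightarrow> w' \<in> planar_proj P (- d) e \<Longrightarrow>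
      ((1 - \<tau>) *\<^sub>R (1, 0) + \<tau> *\<^sub>R (0, 1)) \<bullet> w' \<le> ((1 - \<tau>) *\<^sub>R (1, 0) + \<tau> *\<^sub>R (0, 1)) \<bullet> w"
    unfolding shadow_vertices_def extreme_point_of_def by blast
  obtain x where x: "x \<in> P" and wx: "w = (- (d \<bullet> x), e \<bullet> x)" using w by (auto simp: planar_proj_def)
  define g where "g = d \<bullet> x"
  have g0: "0 \<le> g" using gap_nonneg[OF x] by (simp add: g_def)
  have opt': "\<tau> * (e \<bullet> y) - (1 - \<tau>) * (d \<bullet> y) \<le> \<tau> * (e \<bullet> x) - (1 - \<tau>) * g"
    if "\<tau> \<in> {l<..<u}" "y \<in> P" for \<tau> y
    using opt[OF that(1), of "(- (d \<bullet> y), e \<bullet> y)"] that(2)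
    by (auto simp: planar_proj_def wx g_def inner_Pair)
  \<comment> \<open>Passes from points of \<open>P\<close> to the value function: a maximizer for
    the bound \<open>y\<close> has gap at most \<open>y\<close>, and \<open>1 - \<tau>\<close> is
    nonnegative.\<close>
  have dom: "\<tau> * h y - (1 - \<tau>) * y \<le> \<tau> * (e \<bullet> x) - (1 - \<tau>) * g"
    if \<tau>: "\<tau> \<in> {l<..<u}" and y: "0 \<le> y" for \<tau> y
  proof -
    obtain z where z: "z \<in> P" "d \<bullet> z \<le> y" "e \<bullet> z = h y" using attained[OF y] by auto
    have "(1 - \<tau>) * (d \<bullet> z) \<le> (1 - \<tau>) * y" using \<tau> lu z by (simp add: mult_left_mono)
    then show ?thesis using opt'[OF \<tau> z(1)] z(3) by simp
  qed
  \<comment> \<open>Two points at thirds of the parameter interval give two distinct slopes and stay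
    away from 0 and 1.\<close>
  define \<sigma> where "\<sigma> = (2 * l + u) / 3"
  define \<tau> where "\<tau> = (l + 2 * u) / 3"
  have st: "\<sigma> \<in> {l<..<u}" "\<tau> \<in> {l<..<u}" "\<sigma> < \<tau>" "0 < \<sigma>" "\<tau> < 1"
    using lu by (auto simp: \<sigma>_def \<tau>_def)
  \<comment> \<open>Comparison at the bound \<open>g\<close> itself puts \<open>w\<close> on the
    upper envelope.\<close>
  have "\<tau> * h g \<le> \<tau> * (e \<bullet> x)" using dom[OF st(2) g0] by simp
  then have hg: "h g = e \<bullet> x"
    using st upper[OF x, of g] by (auto simp: g_def)
  have supp: "supp_slope h g ((1 - \<rho>) / \<rho>)" if "\<rho> \<in> {l<..<u}" for \<rho>
    unfolding supp_slope_def
  proof (intro allI impI)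
    fix y :: real assume "0 \<le> y"
    have \<rho>: "0 < \<rho>" using that lu by auto
    have "\<rho> * h y \<le> \<rho> * h g + (1 - \<rho>) * (y - g)"
      using dom[OF that \<open>0 \<le> y\<close>] by (simp add: hg algebra_simps)
    also have "\<dots> = \<rho> * (h g + (1 - \<rho>) / \<rho> * (y - g))"
      using \<rho> by (simp add: distrib_left)
    finally show "h y \<le> h g + (1 - \<rho>) / \<rho> * (y - g)"
      using \<rho> by (simp only: mult_le_cancel_left_pos)
  qed
  have "(1 - \<tau>) / \<tau> < (1 - \<sigma>) / \<sigma>" "0 \<le> (1 - \<tau>) / \<tau>"
    using st by (auto simp: field_simps)
  then have "g \<in> breakpoints h"
    using breakpointsI[OF g0] supp st(1,2) by blast
  then show "w \<in> (\<lambda>g. (- g, h g)) ` breakpoints h"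
    using wx hg by (auto simp: g_def)
next
  fix w assume "w \<in> (\<lambda>g. (- g, h g)) ` breakpoints h"
  then obtain g \<kappa> \<mu> where w: "w = (- g, h g)" and g0: "0 \<le> g" and km: "0 \<le> \<kappa>" "\<kappa> < \<mu>"
    and supp: "supp_slope h g \<kappa>" "supp_slope h g \<mu>"
    by (auto simp: breakpoints_def)
  obtain x where x: "x \<in> P" "d \<bullet> x \<le> g" "e \<bullet> x = h g" using attained[OF g0] by auto
  have "e \<bullet> x \<le> h g + \<mu> * (d \<bullet> x - g)"
    using upper[OF x(1) order_refl] supp(2) gap_nonneg[OF x(1)]
    unfolding supp_slope_def by fastforce
  then have "0 \<le> \<mu> * (d \<bullet> x - g)" using x(3) by simp
  then have dx: "d \<bullet> x = g" using x(2) km by (auto simp: zero_le_mult_iff)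
  have wP: "w \<in> planar_proj P (- d) e"
    using x dx by (auto simp: planar_proj_def w)
  have dom: "snd w' + \<nu> * fst w' \<le> h g - \<nu> * g"
    if w': "w' \<in> planar_proj P (- d) e" and "\<nu> = \<kappa> \<or> \<nu> = \<mu>" for w' \<nu>
  proof -
    obtain y where y: "y \<in> P" "w' = (- (d \<bullet> y), e \<bullet> y)" using w' by (auto simp: planar_proj_def)
    have "h (d \<bullet> y) \<le> h g + \<nu> * (d \<bullet> y - g)"
      using supp that(2) gap_nonneg[OF y(1)] by (auto simp: supp_slope_def)
    then show ?thesis using upper[OF y(1) order_refl] by (simp add: y(2) algebra_simps)
  qed
  have "w extreme_point_of planar_proj P (- d) e"
    unfolding extreme_point_of_def
  proof (intro conjI ballI notI)
    fix a b assume a: "a \<in> planar_proj P (- d) e" and b: "b \<in> planar_proj P (- d) e"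
      and "w \<in> open_segment a b"
    then obtain u where u: "a \<noteq> b" "0 < u" "u < 1" "w = (1 - u) *\<^sub>R a + u *\<^sub>R b"
      by (auto simp: in_segment)
    \<comment> \<open>The slacks of \<open>a\<close> and \<open>b\<close> below a supporting line
      through \<open>w\<close> are nonnegative with weighted mean 0, so both vanish. Two lines of
      different slopes meet in a single point, forcing \<open>a = b\<close>.\<close>
    have eq: "snd a + \<nu> * fst a = h g - \<nu> * g \<and> snd b + \<nu> * fst b = h g - \<nu> * g"
      if \<nu>: "\<nu> = \<kappa> \<or> \<nu> = \<mu>" for \<nu>
    proof -
      define \<alpha> where "\<alpha> = h g - \<nu> * g - (snd a + \<nu> * fst a)"
      define \<beta> where "\<beta> = h g - \<nu> * g - (snd b + \<nu> * fst b)"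
      have "0 \<le> \<alpha>" "0 \<le> \<beta>" using dom[OF a \<nu>] dom[OF b \<nu>] by (auto simp: \<alpha>_def \<beta>_def)
      moreover have "h g = (1 - u) * snd a + u * snd b" "- g = (1 - u) * fst a + u * fst b"
        using u(4) by (auto simp: w prod_eq_iff)
      then have "h g - \<nu> * g = (1 - u) * (snd a + \<nu> * fst a) + u * (snd b + \<nu> * fst b)"
        by (simp add: algebra_simps)
      then have "(1 - u) * \<alpha> + u * \<beta> = 0" by (simp add: \<alpha>_def \<beta>_def algebra_simps)
      ultimately have "(1 - u) * \<alpha> = 0" "u * \<beta> = 0"
        using u(2,3) by (simp_all add: add_nonneg_eq_0_iff)
      then show ?thesis using u(2,3) by (simp add: \<alpha>_def \<beta>_def)
    qed
    have "(\<mu> - \<kappa>) * (fst a - fst b) = 0"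
      using eq[of \<kappa>] eq[of \<mu>] by (simp add: algebra_simps)
    then have "fst a = fst b" using km by simp
    moreover have "snd a = snd b" using eq[of \<kappa>] \<open>fst a = fst b\<close> by simp
    ultimately show False using u(1) by (simp add: prod_eq_iff)
  qed (rule wP)
  moreover have "((1 - \<tau>) *\<^sub>R (1, 0) + \<tau> *\<^sub>R (0, 1)) \<bullet> w' \<le> ((1 - \<tau>) *\<^sub>R (1, 0) + \<tau> *\<^sub>R (0, 1)) \<bullet> w"
    \<comment> \<open>The parameter \<open>1 / (1 + \<nu>)\<close> has slope \<open>\<nu>\<close>,
      so the larger slope \<open>\<mu>\<close> gives the lower end.\<close>
    if \<tau>: "\<tau> \<in> {1 / (1 + \<mu>)<..<1 / (1 + \<kappa>)}" and w': "w' \<in> planar_proj P (- d) e" for \<tau> w'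
  proof -
    have \<tau>km: "\<tau> * \<kappa> \<le> 1 - \<tau>" "1 - \<tau> \<le> \<tau> * \<mu>" "0 < \<tau>"
      using \<tau> km less_trans[of 0 "1 / (1 + \<mu>)" \<tau>] by (auto simp: field_simps)
    define r where "r = fst w' + g"
    define z where "z = snd w' - h g"
    have "z + \<kappa> * r \<le> 0" "z + \<mu> * r \<le> 0"
      using dom[OF w', of \<kappa>] dom[OF w', of \<mu>] by (auto simp: r_def z_def algebra_simps)
    then have "\<tau> * z + \<tau> * \<kappa> * r \<le> 0" "\<tau> * z + \<tau> * \<mu> * r \<le> 0"
      using \<tau>km(3) by (metis distrib_left mult.assoc mult_le_0_iff less_imp_le)+
    \<comment> \<open>As \<open>1 - \<tau>\<close> lies between \<open>\<tau> * \<kappa>\<close> and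
      \<open>\<tau> * \<mu>\<close>, one of the two bounds applies, according to the sign of
      \<open>r\<close>.\<close>
    moreover have "(1 - \<tau>) * r \<le> max (\<tau> * \<kappa> * r) (\<tau> * \<mu> * r)"
      using mult_right_mono[OF \<tau>km(2), of r] mult_right_mono_neg[OF \<tau>km(1), of r]
      by (cases "0 \<le> r") (auto simp: le_max_iff_disj)
    ultimately have "\<tau> * z + (1 - \<tau>) * r \<le> 0" by linarith
    then show ?thesis
      by (cases w') (simp add: w r_def z_def inner_Pair algebra_simps)
  qed
  moreover have "0 \<le> 1 / (1 + \<mu>)" "1 / (1 + \<mu>) < 1 / (1 + \<kappa>)" "1 / (1 + \<kappa>) \<le> 1"
    using km by (auto simp: field_simps)
  ultimately show "w \<in> shadow_vertices P (- d) e"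
    unfolding shadow_vertices_def by blast
qed

lemma shadow_count_eq: "shadow_count P (- d) e = card (breakpoints h)"
  unfolding shadow_count_def shadow_vertices_eq by (rule card_image) (simp add: inj_on_def)

lemma pw_linear_pieces_shadow_count: "pw_linear_pieces (shadow_count P (- d) e) h"
  unfolding shadow_count_eq
  using pw_linear_pieces_breakpoints[OF concave mono _ affine_off_vertices] finite_extreme by simp

text \<open>\<open>h\<close> itself realizes the count. Any competitor agrees with \<open>h\<close>
  on \<open>{0..}\<close>, where all support conditions are tested, so it has the same breakpoints
  and at least as many pieces.\<close>

lemma straight_line_complexity_eq:
  assumes "\<And>g. 0 \<le> g \<Longrightarrow> 0 \<le> h g"
  shows "straight_line_complexity {(g, z). 0 \<le> g \<and> 0 \<le> z \<and> z = h g} = shadow_count P (- d) e"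
  unfolding straight_line_complexity_def
proof (rule Least_equality)
  show "\<exists>f. pw_linear_pieces (shadow_count P (- d) e) f \<and>
      (\<forall>g\<ge>0. (g, f g) \<in> {(g, z). 0 \<le> g \<and> 0 \<le> z \<and> z = h g})"
    using pw_linear_pieces_shadow_count assms by auto
  fix k assume "\<exists>f. pw_linear_pieces k f \<and> (\<forall>g\<ge>0. (g, f g) \<in> {(g, z). 0 \<le> g \<and> 0 \<le> z \<and> z = h g})"
  then obtain f where f: "pw_linear_pieces k f" "\<And>g. 0 \<le> g \<Longrightarrow> f g = h g" by auto
  have "supp_slope f g = supp_slope h g" if "0 \<le> g" for g
    using f(2) that by (auto simp: supp_slope_def fun_eq_iff)
  then have "breakpoints f = breakpoints h" by (simp add: breakpoints_def cong: conj_cong)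
  then show "shadow_count P (- d) e \<le> k"
    using breakpoints_minimal[OF f(1)] by (simp add: shadow_count_eq)
qed

end

section \<open>Affine slices of the nonnegative orthant\<close>

definition slice_max :: "(real^'n) set \<Rightarrow> real^'n \<Rightarrow> 'n \<Rightarrow> real \<Rightarrow> real" where
  "slice_max P d i g = (GREATEST z. \<exists>x\<in>P. d \<bullet> x \<le> g \<and> z = x $ i)"

text \<open>Common shape of the primal and the dual feasible set. In both uses \<open>d\<close> is
  the optimal point of the opposite problem and \<open>w\<close> a strictly positive feasible point
  of it; their inner products with points of \<open>P\<close> differ by the constant
  \<open>k\<close>.\<close>

locale orthant_slice =
  fixes L P :: "(real^'n) set" and d w :: "real^'n" and k :: real
  assumes affine: "affine L"
    and P_eq: "P = {x \<in> L. \<forall>j. 0 \<le> x $ j}"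
    and gap_nonneg: "\<And>x. x \<in> P \<Longrightarrow> 0 \<le> d \<bullet> x"
    and gap_zero: "\<exists>x\<in>P. d \<bullet> x = 0"
    and w_pos: "\<And>j. 0 < w $ j"
    and w_eq: "\<And>x. x \<in> P \<Longrightarrow> w \<bullet> x = d \<bullet> x + k"
begin

lemma polyhedron: "polyhedron P"
proof -
  have "P = L \<inter> \<Inter>(range (\<lambda>j. {x. axis j 1 \<bullet> x \<ge> 0}))"
    by (auto simp: P_eq inner_axis')
  moreover have "polyhedron (\<Inter>(range (\<lambda>j::'n. {x::real^'n. axis j 1 \<bullet> x \<ge> 0})))"
    by (rule polyhedron_Inter) (auto simp: polyhedron_halfspace_ge)
  ultimately show ?thesis using affine_imp_polyhedron[OF affine] polyhedron_Int by metis
qed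

text \<open>With \<open>m\<close> the smallest entry of \<open>w\<close>,
  \<open>m * norm x \<le> w \<bullet> x\<close>, and \<open>w_eq\<close> bounds the right-hand side
  by \<open>g + k\<close>.\<close>

lemma compact_sublevel: "compact {x \<in> P. d \<bullet> x \<le> g}"
proof -
  define m where "m = Min (range (($) w))"
  have m: "0 < m" "\<And>j. m \<le> w $ j" using w_pos by (auto simp: m_def)
  have "norm x \<le> (g + k) / m" if x: "x \<in> P" "d \<bullet> x \<le> g" for x
  proof -
    have x0: "0 \<le> x $ j" for j using x(1) by (simp add: P_eq)
    have "m * norm x \<le> m * (\<Sum>j\<in>UNIV. \<bar>x $ j\<bar>)"
      using norm_le_l1_cart[of x] m(1) by simp
    also have "\<dots> = (\<Sum>j\<in>UNIV. m * x $ j)" using x0 by (simp add: sum_distrib_left)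
    also have "\<dots> \<le> (\<Sum>j\<in>UNIV. w $ j * x $ j)"
      using m(2) x0 by (intro sum_mono mult_right_mono) auto
    also have "\<dots> = w \<bullet> x" by (simp add: inner_vec_def)
    also have "\<dots> \<le> g + k" using w_eq[OF x(1)] x(2) by simp
    finally show ?thesis using m(1) by (simp add: field_simps)
  qed
  then have "bounded {x \<in> P. d \<bullet> x \<le> g}" by (auto simp: bounded_iff)
  moreover have "{x \<in> P. d \<bullet> x \<le> g} = P \<inter> {x. d \<bullet> x \<le> g}" by auto
  then have "closed {x \<in> P. d \<bullet> x \<le> g}"
    using polyhedron_imp_closed[OF polyhedron] by (simp add: closed_Int closed_halfspace_le)
  ultimately show ?thesis by (simp add: compact_eq_bounded_closed)
qed

text \<open>Compactness makes the \<open>GREATEST\<close> in \<open>slice_max\<close> a genuine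
  maximum once some point is admissible.\<close>

lemma slice_max_attained:
  assumes "x \<in> P" "d \<bullet> x \<le> g"
  shows "(\<exists>y\<in>P. d \<bullet> y \<le> g \<and> y $ i = slice_max P d i g) \<and> x $ i \<le> slice_max P d i g"
proof -
  have "\<exists>y\<in>{x \<in> P. d \<bullet> x \<le> g}. \<forall>z\<in>{x \<in> P. d \<bullet> x \<le> g}. z $ i \<le> y $ i"
    using assms by (intro continuous_attains_sup[OF compact_sublevel] continuous_intros) auto
  then obtain y where y: "y \<in> P" "d \<bullet> y \<le> g" "\<And>z. z \<in> P \<Longrightarrow> d \<bullet> z \<le> g \<Longrightarrow> z $ i \<le> y $ i"
    by auto
  have "slice_max P d i g = y $ i"
    unfolding slice_max_def by (rule Greatest_equality) (use y in auto)
  then show ?thesis using y assms by auto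
qed

sublocale shadow_value P d "axis i 1" "slice_max P d i" for i
proof
  show "convex P" by (rule polyhedron_imp_convex[OF polyhedron])
  show "finite {x. x extreme_point_of P}" by (rule finite_polyhedron_extreme_points[OF polyhedron])
  show "\<exists>x\<in>P. d \<bullet> x \<le> g \<and> axis i 1 \<bullet> x = slice_max P d i g" if "0 \<le> g" for g
    using gap_zero slice_max_attained[of _ g i] that by (auto simp: inner_axis')
  show "axis i 1 \<bullet> x \<le> slice_max P d i g" if "x \<in> P" "d \<bullet> x \<le> g" for x g
    using slice_max_attained[OF that] by (simp add: inner_axis')
qed (use compact_sublevel gap_nonneg in auto)

lemma slice_max_properties:
  "pw_linear_pieces (shadow_count P (- d) (axis i 1)) (slice_max P d i)
    \<and> concave_on {0..} (slice_max P d i) \<and> mono_on {0..} (slice_max P d i)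
    \<and> straight_line_complexity {(g, z). 0 \<le> g \<and> 0 \<le> z \<and> z = slice_max P d i g}
        = shadow_count P (- d) (axis i 1)"
proof -
  have "0 \<le> slice_max P d i g" if g: "0 \<le> g" for g
  proof -
    obtain x where "x \<in> P" "slice_max P d i g = x $ i"
      using attained[OF g, of i] by (auto simp: inner_axis')
    then show ?thesis by (simp add: P_eq)
  qed
  then show ?thesis
    using pw_linear_pieces_shadow_count concave mono straight_line_complexity_eq by blast
qed

end

section \<open>The primal-dual pair and its central path limit\<close>

lemma primal_feasible_eq: "primal_feasible A b = {x \<in> {x. A *v x = b}. \<forall>j. 0 \<le> x $ j}"
  by (auto simp: primal_feasible_def)

lemma dual_feasible_eq:
  "dual_feasible A c = {s \<in> {s. \<exists>y. transpose A *v y + s = c}. \<forall>j. 0 \<le> s $ j}"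
  by (auto simp: dual_feasible_def)

lemma affine_primal: "affine {x. A *v x = (b :: real^'m)}"
  by (auto simp: affine_def matrix_vector_right_distrib matrix_vector_mult_scaleR
      simp flip: scaleR_left_distrib)

lemma affine_dual: "affine {s. \<exists>y. transpose (A :: real^'n^'m) *v y + s = c}"
  unfolding affine_def
proof (intro ballI allI impI CollectI, clarify)
  fix s y s' y' and u v :: real
  assume eq: "transpose A *v y' + s' = transpose A *v y + s" and uv: "u + v = 1"
  have "transpose A *v (u *\<^sub>R y + v *\<^sub>R y') + (u *\<^sub>R s + v *\<^sub>R s')
      = u *\<^sub>R (transpose A *v y + s) + v *\<^sub>R (transpose A *v y' + s')"
    by (simp add: matrix_vector_right_distrib matrix_vector_mult_scaleR scaleR_right_distrib
        del: transpose_matrix_vector)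
  also have "\<dots> = transpose A *v y + s"
    unfolding eq using uv by (simp flip: scaleR_left_distrib)
  finally show "\<exists>z. transpose A *v z + (u *\<^sub>R s + v *\<^sub>R s') = transpose A *v y + s" ..
qed

text \<open>Moving \<open>A\<close> across the inner product turns the \<open>y\<close> part into
  \<open>b \<bullet> y\<close>, so \<open>s \<bullet> x\<close> is the duality gap.\<close>

lemma inner_eq_dual_objective:
  fixes A :: "real^'n^'m"
  assumes "A *v x = b" "transpose A *v y + s = c"
  shows "c \<bullet> x = b \<bullet> y + s \<bullet> x"
proof -
  have "(transpose A *v y) \<bullet> x = y \<bullet> b"
    using assms(1) by (simp add: dot_lmul_matrix)
  then show ?thesis
    unfolding assms(2)[symmetric] by (simp only: inner_add_left inner_commute[of b])
qed

lemma inner_nonneg_orthant: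
  fixes x s :: "real^'n"
  assumes "\<And>j. 0 \<le> x $ j" "\<And>j. 0 \<le> s $ j"
  shows "0 \<le> x \<bullet> s"
  using assms by (simp add: inner_vec_def sum_nonneg)

theorem lemma1p5:
  fixes A :: "real^'n^'m" and b :: "real^'m" and c :: "real^'n"
    and xcp scp :: "real \<Rightarrow> real^'n" and xstar sstar :: "real^'n"
  assumes "rank A = CARD('m)"
    and "\<exists>x\<in>primal_feasible A b. \<forall>j. 0 < x $ j"
    and "\<exists>s\<in>dual_feasible A c. \<forall>j. 0 < s $ j"
    and "\<And>\<mu>. 0 < \<mu> \<Longrightarrow> central_point A b c \<mu> (xcp \<mu>) (scp \<mu>)"
    and "(xcp \<longlongrightarrow> xstar) (at_right 0)"
    and "(scp \<longlongrightarrow> sstar) (at_right 0)"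
  shows "(\<forall>i. pw_linear_pieces (shadow_count (primal_feasible A b) (- sstar) (axis i 1)) (x_max A b c i)
            \<and> concave_on {0..} (x_max A b c i) \<and> mono_on {0..} (x_max A b c i)
            \<and> SLC_primal A b c i = shadow_count (primal_feasible A b) (- sstar) (axis i 1))
       \<and> (\<forall>i. pw_linear_pieces (shadow_count (dual_feasible A c) (- xstar) (axis i 1)) (s_max A b c i)
            \<and> concave_on {0..} (s_max A b c i) \<and> mono_on {0..} (s_max A b c i)
            \<and> SLC_dual A b c i = shadow_count (dual_feasible A c) (- xstar) (axis i 1))"
proof -
  let ?P = "primal_feasible A b" and ?D = "dual_feasible A c"
  \<comment> \<open>Closedness keeps the limits of the central path feasible.\<close>
  have closed: "closed ?P" "closed ?D"
    unfolding primal_feasible_eq dual_feasible_eq Collect_conj_eq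
    using affine_closed[OF affine_primal] affine_closed[OF affine_dual]
    by (auto intro!: closed_Int closed_Collect_all closed_Collect_le continuous_intros)
  have pos: "\<forall>\<^sub>F \<mu> in at_right 0. (0::real) < \<mu>" by (rule eventually_at_right_less)
  have cp: "\<forall>\<^sub>F \<mu> in at_right 0. central_point A b c \<mu> (xcp \<mu>) (scp \<mu>)"
    using pos by eventually_elim (rule assms(4))
  have xstar: "xstar \<in> ?P"
    by (rule Lim_in_closed_set[OF closed(1) _ _ assms(5)])
      (use cp in \<open>auto elim: eventually_mono simp: central_point_def\<close>)
  have sstar: "sstar \<in> ?D"
    by (rule Lim_in_closed_set[OF closed(2) _ _ assms(6)])
      (use cp in \<open>auto elim: eventually_mono simp: central_point_def\<close>)
  \<comment> \<open>All coordinate products equal \<open>\<mu>\<close>, so the inner product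
    vanishes in the limit.\<close>
  have "\<forall>\<^sub>F \<mu> in at_right 0. real CARD('n) * \<mu> = xcp \<mu> \<bullet> scp \<mu>"
    using cp by eventually_elim (simp add: central_point_def inner_vec_def)
  moreover have "((\<lambda>\<mu>. real CARD('n) * \<mu>) \<longlongrightarrow> real CARD('n) * 0) (at_right 0)"
    by (intro tendsto_intros)
  ultimately have "((\<lambda>\<mu>. xcp \<mu> \<bullet> scp \<mu>) \<longlongrightarrow> real CARD('n) * 0) (at_right 0)"
    by (rule Lim_transform_eventually[rotated])
  then have compl: "xstar \<bullet> sstar = 0"
    using tendsto_unique[OF _ tendsto_inner[OF assms(5,6)]] by simp
  obtain ystar where ystar: "transpose A *v ystar + sstar = c"
    using sstar by (auto simp: dual_feasible_def)
  have obj: "c \<bullet> x = b \<bullet> ystar + sstar \<bullet> x" if "x \<in> ?P" for x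
    using inner_eq_dual_objective[OF _ ystar] that by (simp add: primal_feasible_def)
  have obj': "c \<bullet> xstar = b \<bullet> y + xstar \<bullet> s" if "transpose A *v y + s = c" for y s
    using inner_eq_dual_objective[OF _ that, of xstar b] xstar
    by (simp add: primal_feasible_def inner_commute)
  have gap: "0 \<le> sstar \<bullet> x" if "x \<in> ?P" for x
    using that sstar by (intro inner_nonneg_orthant) (auto simp: primal_feasible_def dual_feasible_def)
  have gap': "0 \<le> xstar \<bullet> s" if "s \<in> ?D" for s
    using that xstar by (intro inner_nonneg_orthant) (auto simp: primal_feasible_def dual_feasible_def)
  \<comment> \<open>The value of \<open>ystar\<close> is a lower bound for the primal, and
    complementarity lets \<open>xstar\<close> attain it.\<close>
  have opt: "opt_value A b c = b \<bullet> ystar"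
    unfolding opt_value_def
    by (rule Least_equality) (use obj gap xstar compl in \<open>auto simp: inner_commute intro!: bexI[of _ xstar]\<close>)
  have opt': "opt_value A b c = c \<bullet> xstar"
    using obj[OF xstar] compl by (simp add: opt inner_commute)
  obtain x0 where x0: "x0 \<in> ?P" "\<And>j. 0 < x0 $ j" using assms(2) by auto
  obtain s0 y0 where s0: "\<And>j. 0 < s0 $ j" "transpose A *v y0 + s0 = c"
    using assms(3) by (auto simp: dual_feasible_def)
  \<comment> \<open>The strictly positive dual slack \<open>s0\<close> is the weight; subtracting
    the identities for \<open>s0\<close> and \<open>sstar\<close> leaves a difference of dual
    objectives.\<close>
  have primal: "orthant_slice {x. A *v x = b} ?P sstar s0 (b \<bullet> ystar - b \<bullet> y0)"
  proof
    show "\<exists>x\<in>?P. sstar \<bullet> x = 0" using xstar compl by (auto simp: inner_commute)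
    show "s0 \<bullet> x = sstar \<bullet> x + (b \<bullet> ystar - b \<bullet> y0)" if "x \<in> ?P" for x
      using inner_eq_dual_objective[OF _ s0(2), of x b] obj[OF that] that
      by (simp add: primal_feasible_def)
  qed (fact affine_primal primal_feasible_eq gap s0(1))+
  \<comment> \<open>The roles are exchanged: the strictly positive primal point \<open>x0\<close>
    bounds the dual slacks.\<close>
  have dual: "orthant_slice {s. \<exists>y. transpose A *v y + s = c} ?D xstar x0 (c \<bullet> x0 - c \<bullet> xstar)"
  proof
    show "\<exists>s\<in>?D. xstar \<bullet> s = 0" using sstar compl by auto
    show "x0 \<bullet> s = xstar \<bullet> s + (c \<bullet> x0 - c \<bullet> xstar)" if s: "s \<in> ?D" for s
    proof -
      obtain y where y: "transpose A *v y + s = c" using s by (auto simp: dual_feasible_def)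
      show ?thesis
        using inner_eq_dual_objective[OF _ y, of x0 b] x0(1) obj'[OF y]
        by (simp add: primal_feasible_def inner_commute)
    qed
  qed (fact affine_dual dual_feasible_eq gap' x0(2))+
  \<comment> \<open>The budget on \<open>c \<bullet> x\<close> becomes
    \<open>sstar \<bullet> x \<le> g\<close>, because \<open>opt_value\<close> is the objective of
    \<open>ystar\<close>.\<close>
  have x_max: "x_max A b c i = slice_max ?P sstar i" for i
  proof
    fix g
    have "(\<exists>x. A *v x = b \<and> (\<forall>j. 0 \<le> x $ j) \<and> c \<bullet> x \<le> opt_value A b c + g \<and> z = x $ i)
        \<longleftrightarrow> (\<exists>x\<in>?P. sstar \<bullet> x \<le> g \<and> z = x $ i)" for z
      using obj opt by (auto simp: primal_feasible_def)
    then show "x_max A b c i g = slice_max ?P sstar i g"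
      by (simp add: x_max_def slice_max_def)
  qed
  have s_max: "s_max A b c i = slice_max ?D xstar i" for i
  proof
    fix g
    have le: "opt_value A b c - g \<le> b \<bullet> y \<longleftrightarrow> xstar \<bullet> s \<le> g" if "transpose A *v y + s = c" for s y
      using obj'[OF that] by (auto simp: opt')
    have "(\<exists>s y. transpose A *v y + s = c \<and> (\<forall>j. 0 \<le> s $ j) \<and> opt_value A b c - g \<le> b \<bullet> y \<and> z = s $ i)
        \<longleftrightarrow> (\<exists>s\<in>?D. xstar \<bullet> s \<le> g \<and> z = s $ i)" for z
      unfolding dual_feasible_def using le by blast
    then show "s_max A b c i g = slice_max ?D xstar i g"
      unfolding s_max_def slice_max_def by presburger
  qed
  show ?thesis
    unfolding SLC_primal_def SLC_dual_def x_max s_max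
    using orthant_slice.slice_max_properties[OF primal] orthant_slice.slice_max_properties[OF dual]
    by blast
qed

end
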